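(* Let $d>1$. Suppose $q$ is a distribution defined on $\mathbb{R}^d$, and $f$ is a flow composed of finitely many ReLU Sylvester flows on $\mathbb{R}^d$. Let $p=f\#q$. Then there exists a closed set $\Omega\subset\mathbb{R}^d$ of measure zero such that for all $z\in\mathbb{R}^d\setminus\Omega$, \[J_f(z)^{\top}\,(\nabla\log p)(f(z))=\nabla\log q(z),\] where $(\nabla \log p)(f(z))$ denotes the gradient of $\log p$ evaluated at the point $f(z)$.
   Context: Distributions on $\mathbb{R}^d$ are identified with their densities. A normalizing flow on $\mathbb{R}^d$ is an invertible function $f:\mathbb{R}^d\to\mathbb{R}^d$ that is differentiable almost everywhere with $\det J_f(z)\neq0$ for almost every $z$, where $J_f$ is the Jacobian matrix. If $z$ has density $q$, then $f\#q$ denotes the density of $f(z)$, given by $(f\#q)(f(z))=q(z)/|\det J_f(z)|$. A ReLU Sylvester flow on $\mathbb{R}^d$ is a normalizing flow of the form $f(z)=z+A\,\mathrm{ReLU}(B^{\top}z+b)$ with $m<d$, $A,B\in\mathbb{R}^{d\times m}$, $b\in\mathbb{R}^m$, where $\mathrm{ReLU}(x)=\max(x,0)$ is applied coordinate-wise. Different flows in the composition may have different $m$. *)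

theory Defs
  imports "HOL-Probability.Probability"
begin

definition prob_density :: "(real^'n \<Rightarrow> real) \<Rightarrow> bool" where
  "prob_density q \<longleftrightarrow>
     q \<in> borel_measurable borel \<and> (\<forall>x. 0 \<le> q x) \<and>
     prob_space (density lborel (\<lambda>x. ennreal (q x)))"

definition regular_point :: "(real^'n \<Rightarrow> real^'n) \<Rightarrow> real^'n \<Rightarrow> bool" where
  "regular_point f z \<longleftrightarrow> f differentiable (at z) \<and> det (jacobian f (at z)) \<noteq> 0"

definition normalizing_flow :: "(real^'n \<Rightarrow> real^'n) \<Rightarrow> bool" where
  "normalizing_flow f \<longleftrightarrow> bij f \<and> (AE z in lborel. regular_point f z)"

text \<open>The equation \<open>(f # q) (f z) = q z / \<bar>det (J\<^sub>f z)\<bar>\<close>, solved for \<open>y = f z\<close> with \<open>f\<close> bijective.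
  It is meaningful at the images of the regular points of \<open>f\<close>; at other points the value is
  arbitrary.\<close>

definition pushforward_density ::
    "(real^'n \<Rightarrow> real^'n) \<Rightarrow> (real^'n \<Rightarrow> real) \<Rightarrow> real^'n \<Rightarrow> real" where
  "pushforward_density f q y = q (inv f y) / \<bar>det (jacobian f (at (inv f y)))\<bar>"

definition relu :: "real \<Rightarrow> real" where
  "relu x = max x 0"

text \<open>The width \<open>m\<close> varies from flow to flow and is bounded by the dimension, so it is a number and
  not an index type. The \<open>d \<times> m\<close> matrices are given by their columns \<open>A j\<close> and \<open>B j\<close> for
  \<open>j < m\<close>: coordinate \<open>j\<close> of \<open>B\<^sup>T z + b\<close> is \<open>B j \<bullet> z + b j\<close>, and \<open>A v\<close> is the
  combination of the columns of \<open>A\<close> with the coordinates of \<open>v\<close>.\<close>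

definition sylvester_map ::
    "nat \<Rightarrow> (nat \<Rightarrow> real^'n) \<Rightarrow> (nat \<Rightarrow> real^'n) \<Rightarrow> (nat \<Rightarrow> real) \<Rightarrow> real^'n \<Rightarrow> real^'n" where
  "sylvester_map m A B b z = z + (\<Sum>j<m. relu (B j \<bullet> z + b j) *\<^sub>R A j)"

definition relu_sylvester_flow :: "(real^'n \<Rightarrow> real^'n) \<Rightarrow> bool" where
  "relu_sylvester_flow f \<longleftrightarrow>
     normalizing_flow f \<and> (\<exists>m A B b. m < CARD('n) \<and> f = sylvester_map m A B b)"

inductive composed_relu_sylvester :: "(real^'n \<Rightarrow> real^'n) \<Rightarrow> bool" where
  single: "relu_sylvester_flow f \<Longrightarrow> composed_relu_sylvester f"
| comp: "relu_sylvester_flow g \<Longrightarrow> composed_relu_sylvester f \<Longrightarrow> composed_relu_sylvester (g \<circ> f)"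

definition gradient :: "('a::real_inner \<Rightarrow> real) \<Rightarrow> 'a \<Rightarrow> 'a" where
  "gradient \<phi> x = (THE D. GDERIV \<phi> x :> D)"

text \<open>A density may vanish, and \<open>ln\<close> is total with an arbitrary value at \<open>0\<close>. So \<open>\<nabla> log q\<close> counts as
  defined at \<open>z\<close> only if \<open>q\<close> is positive near \<open>z\<close>.\<close>

definition log_differentiable_at :: "(real^'n \<Rightarrow> real) \<Rightarrow> real^'n \<Rightarrow> bool" where
  "log_differentiable_at q z \<longleftrightarrow>
     (\<forall>\<^sub>F x in nhds z. 0 < q x) \<and> (\<lambda>x. ln (q x)) differentiable (at z)"

end

theory Submission
  imports Defs
begin

text \<open>Off the finitely many hyperplanes \<open>B j \<bullet> z + b j = 0\<close> a ReLU Sylvester flow is locally affine,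
  and regularity almost everywhere forces each affine piece to be invertible. Invertible affine
  pieces pull closed negligible sets back to closed negligible sets, so a composition is locally an
  invertible affine map \<open>x \<mapsto> M x + c\<close> off a closed negligible set. Near such a point
  \<open>p (f x) = q x / \<bar>det M\<bar>\<close> with a constant denominator, so the logarithms of both sides differ by a
  constant and the claim is the chain rule.\<close>

section \<open>Maps that are affine near a point\<close>

text \<open>The linear part \<open>M\<close> is a parameter because it will be the Jacobian; the
  offset stays hidden. The filter \<open>nhds z\<close> includes \<open>z\<close> itself, so the
  formula also gives the value of \<open>f\<close> there.\<close>

definition locally_affine_with :: "real^'n^'n \<Rightarrow> (real^'n \<Rightarrow> real^'n) \<Rightarrow> real^'n \<Rightarrow> bool" where
  "locally_affine_with M f z \<longleftrightarrow> (\<exists>c. \<forall>\<^sub>F x in nhds z. f x = M *v x + c)"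

lemma has_derivative_locally_affine:
  assumes "locally_affine_with M f z"
  shows "(f has_derivative (*v) M) (at z)"
proof -
  obtain c where c: "\<forall>\<^sub>F x in nhds z. f x = M *v x + c"
    using assms by (auto simp: locally_affine_with_def)
  have "((\<lambda>x. M *v x + c) has_derivative (*v) M) (at z)"
    by (intro has_derivative_add_const bounded_linear_imp_has_derivative
        matrix_vector_mul_bounded_linear)
  moreover have "\<forall>\<^sub>F x in at z. M *v x + c = f x"
    using c by (auto simp: eventually_at_filter elim: eventually_mono)
  moreover have "M *v z + c = f z"
    using eventually_nhds_x_imp_x[OF c] by simp
  ultimately show ?thesis
    by (rule has_derivative_transform_eventually) simp
qed

lemma jacobian_locally_affine:
  assumes "locally_affine_with M f z"
  shows "jacobian f (at z) = M"
  using has_derivative_locally_affine[OF assms]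
  by (metis jacobian_def frechet_derivative_at matrix_of_matrix_vector_mul)

lemma regular_point_locally_affine:
  assumes "locally_affine_with M f z" "det M \<noteq> 0"
  shows "regular_point f z"
  using assms has_derivative_locally_affine jacobian_locally_affine
  by (metis regular_point_def differentiable_def)

text \<open>One affine formula on an open set serves every point of that set. Hence the Jacobian is
  constant near \<open>z\<close>, and so is the denominator of the pushforward density.\<close>

lemma locally_affine_with_eventually:
  assumes "locally_affine_with M f z"
  shows "\<forall>\<^sub>F x in nhds z. locally_affine_with M f x"
proof -
  obtain c where "\<forall>\<^sub>F x in nhds z. f x = M *v x + c"
    using assms by (auto simp: locally_affine_with_def)
  then have "\<forall>\<^sub>F y in nhds z. \<forall>\<^sub>F x in nhds y. f x = M *v x + c"
    by (simp add: eventually_eventually)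
  then show ?thesis
    by (rule eventually_mono) (auto simp: locally_affine_with_def)
qed

lemma locally_affine_with_add:
  assumes "locally_affine_with M f z" "locally_affine_with N g z"
  shows "locally_affine_with (M + N) (\<lambda>x. f x + g x) z"
proof -
  obtain c d where "\<forall>\<^sub>F x in nhds z. f x = M *v x + c" "\<forall>\<^sub>F x in nhds z. g x = N *v x + d"
    using assms by (auto simp: locally_affine_with_def)
  then have "\<forall>\<^sub>F x in nhds z. f x + g x = (M + N) *v x + (c + d)"
    by eventually_elim (simp add: matrix_vector_mult_add_rdistrib)
  then show ?thesis
    by (auto simp: locally_affine_with_def)
qed

lemma isCont_filterlim_nhds: "isCont f x \<Longrightarrow> filterlim f (nhds (f x)) (nhds x)"
  by (simp add: isCont_def tendsto_at_iff_tendsto_nhds)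

lemma locally_affine_with_compose:
  assumes "locally_affine_with M f z" "locally_affine_with N g (f z)"
  shows "locally_affine_with (N ** M) (g \<circ> f) z"
proof -
  obtain c d where c: "\<forall>\<^sub>F x in nhds z. f x = M *v x + c"
    and d: "\<forall>\<^sub>F y in nhds (f z). g y = N *v y + d"
    using assms by (auto simp: locally_affine_with_def)
  have "isCont f z"
    using has_derivative_continuous[OF has_derivative_locally_affine[OF assms(1)]] .
  then have "filterlim f (nhds (f z)) (nhds z)"
    by (rule isCont_filterlim_nhds)
  from eventually_compose_filterlim[OF d this] c
  have "\<forall>\<^sub>F x in nhds z. (g \<circ> f) x = (N ** M) *v x + (N *v c + d)"
    by eventually_elim
      (simp add: matrix_vector_right_distrib matrix_vector_mul_assoc add.assoc)
  then show ?thesis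
    by (auto simp: locally_affine_with_def)
qed

section \<open>ReLU Sylvester maps off their hyperplanes\<close>

text \<open>Off the hyperplane the sign of the argument is locally constant, so the term is locally
  either affine of rank at most one or zero. For \<open>u = 0\<close> it is constant, even at the
  kink \<open>t = 0\<close>.\<close>

lemma locally_affine_relu:
  fixes u v z :: "real^'n"
  assumes "u = 0 \<or> u \<bullet> z + t \<noteq> 0"
  shows "\<exists>M. locally_affine_with M (\<lambda>x. relu (u \<bullet> x + t) *\<^sub>R v) z"
proof -
  consider "u = 0" | "u \<bullet> z + t > 0" | "u \<bullet> z + t < 0"
    using assms by linarith
  then show ?thesis
  proof cases
    case 1
    then have "locally_affine_with 0 (\<lambda>x. relu (u \<bullet> x + t) *\<^sub>R v) z"
      by (auto simp: locally_affine_with_def)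
    then show ?thesis ..
  next
    case 2
    let ?L = "\<lambda>x. (u \<bullet> x) *\<^sub>R v"
    have "linear ?L"
      by (simp add: linear_iff inner_add_right scaleR_add_left)
    then have L: "matrix ?L *v x = ?L x" for x
      by (rule fun_cong[OF matrix_vector_mul(2)])
    have "open {x. u \<bullet> x + t > 0}"
      by (intro open_Collect_less continuous_intros)
    then have "\<forall>\<^sub>F x in nhds z. u \<bullet> x + t > 0"
      using 2 by (auto simp: eventually_nhds)
    then have "\<forall>\<^sub>F x in nhds z. relu (u \<bullet> x + t) *\<^sub>R v = matrix ?L *v x + t *\<^sub>R v"
      by eventually_elim (simp add: relu_def L scaleR_add_left)
    then show ?thesis
      by (auto simp: locally_affine_with_def)
  next
    case 3
    have "open {x. u \<bullet> x + t < 0}"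
      by (intro open_Collect_less continuous_intros)
    then have "\<forall>\<^sub>F x in nhds z. u \<bullet> x + t < 0"
      using 3 by (auto simp: eventually_nhds)
    then have "\<forall>\<^sub>F x in nhds z. relu (u \<bullet> x + t) *\<^sub>R v = 0 *v x + 0"
      by eventually_elim (simp add: relu_def)
    then show ?thesis
      unfolding locally_affine_with_def by blast
  qed
qed

lemma locally_affine_sylvester_map:
  assumes "\<forall>j<m. B j = 0 \<or> B j \<bullet> z + b j \<noteq> 0"
  shows "\<exists>M. locally_affine_with M (sylvester_map m A B b) z"
  using assms
proof (induction m)
  case 0
  have "locally_affine_with (mat 1) (sylvester_map 0 A B b) z"
    by (auto simp: locally_affine_with_def sylvester_map_def)
  then show ?case ..
next
  case (Suc m)
  then obtain M N where "locally_affine_with M (sylvester_map m A B b) z"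
    "locally_affine_with N (\<lambda>x. relu (B m \<bullet> x + b m) *\<^sub>R A m) z"
    using locally_affine_relu by (metis less_Suc_eq)
  from locally_affine_with_add[OF this] show ?case
    by (auto simp: sylvester_map_def add.assoc)
qed

lemma continuous_on_sylvester_map: "continuous_on S (sylvester_map m A B b)"
  unfolding sylvester_map_def relu_def by (intro continuous_intros)

text \<open>A nonempty open set is not null, so the neighbourhood of \<open>z\<close> on which
  \<open>M\<close> is the linear part contains a regular point, and the Jacobian there is
  \<open>M\<close>.\<close>

lemma det_nonzero_if_AE_regular:
  assumes "AE x in lborel. regular_point f x" "locally_affine_with M f z"
  shows "det M \<noteq> 0"
proof -
  obtain U where U: "open U" "z \<in> U" "\<And>x. x \<in> U \<Longrightarrow> locally_affine_with M f x"
    using locally_affine_with_eventually[OF assms(2)] by (auto simp: eventually_nhds)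
  obtain N where N: "N \<in> null_sets lborel" "\<And>x. x \<notin> N \<Longrightarrow> regular_point f x"
    by (rule AE_E3[OF assms(1)]) (use that in auto)
  have "\<not> U \<subseteq> N"
    using N(1) U(1,2) negligible_subset open_not_negligible
    by (metis empty_iff negligible_iff_null_sets null_sets_completionI)
  then obtain x where "x \<in> U" "regular_point f x"
    using N(2) by auto
  then show ?thesis
    using U(3) jacobian_locally_affine by (metis regular_point_def)
qed

section \<open>Exceptional sets and composition\<close>

text \<open>\<open>N\<close> may be larger than the set of bad points, which leaves room to add
  preimages under composition. The matrix \<open>M\<close> may change from point to point.\<close>

definition invertibly_affine_off :: "(real^'n) set \<Rightarrow> (real^'n \<Rightarrow> real^'n) \<Rightarrow> bool" where
  "invertibly_affine_off N f \<longleftrightarrow>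
     closed N \<and> negligible N \<and> (\<forall>z. z \<notin> N \<longrightarrow> (\<exists>M. locally_affine_with M f z \<and> det M \<noteq> 0))"

lemma relu_sylvester_flow_affine_off:
  assumes "relu_sylvester_flow g"
  shows "\<exists>N. invertibly_affine_off N g"
proof -
  obtain m A B b where g: "g = sylvester_map m A B b" and reg: "AE x in lborel. regular_point g x"
    using assms by (auto simp: relu_sylvester_flow_def normalizing_flow_def)
  \<comment> \<open>Zero columns are left out: for \<open>B j = 0\<close> and \<open>b j = 0\<close>
    the set would be the whole space.\<close>
  define N where "N = (\<Union>j\<in>{j. j < m \<and> B j \<noteq> 0}. {x. B j \<bullet> x = - b j})"
  have "closed N"
    unfolding N_def by (intro closed_UN) (auto simp: closed_hyperplane)
  moreover have "negligible N"
    unfolding N_def by (intro negligible_Union) (auto simp: negligible_hyperplane)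
  moreover have "\<exists>M. locally_affine_with M g z \<and> det M \<noteq> 0" if "z \<notin> N" for z
  proof -
    have "\<forall>j<m. B j = 0 \<or> B j \<bullet> z + b j \<noteq> 0"
      using that by (auto simp: N_def eq_neg_iff_add_eq_0)
    then obtain M where "locally_affine_with M g z"
      using locally_affine_sylvester_map g by blast
    then show ?thesis
      using det_nonzero_if_AE_regular[OF reg] by blast
  qed
  ultimately show ?thesis
    by (auto simp: invertibly_affine_off_def)
qed

lemma affine_inverse:
  fixes M :: "real^'n^'n"
  assumes "det M \<noteq> 0"
  shows "matrix_inv M *v (M *v x + c) - matrix_inv M *v c = x"
    and "M *v (matrix_inv M *v y - matrix_inv M *v c) + c = y"
proof -
  have "invertible M"
    using assms invertible_det_nz by blast
  then have "matrix_inv M ** M = mat 1" "M ** matrix_inv M = mat 1"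
    using someI_ex[of "\<lambda>N. M ** N = mat 1 \<and> N ** M = mat 1"]
    by (simp_all add: invertible_def matrix_inv_def)
  then show "matrix_inv M *v (M *v x + c) - matrix_inv M *v c = x"
    "M *v (matrix_inv M *v y - matrix_inv M *v c) + c = y"
    by (simp_all add: matrix_vector_right_distrib matrix_vector_mult_diff_distrib
        matrix_vector_mul_assoc)
qed

text \<open>Near a point outside \<open>N\<close> the preimage lies in the image of \<open>S\<close>
  under the inverse of the affine piece, and a differentiable image of a null set is null. Local
  negligibility then gives negligibility off \<open>N\<close>, and \<open>N\<close> itself is
  null.\<close>

lemma negligible_vimage:
  assumes "invertibly_affine_off N f" "negligible S"
  shows "negligible (f -` S)"
proof -
  have "negligible (f -` S - N)"
    unfolding locally_negligible_alt[of "f -` S - N"]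
  proof
    fix z assume z: "z \<in> f -` S - N"
    then obtain M c where "det M \<noteq> 0" and "\<forall>\<^sub>F x in nhds z. f x = M *v x + c"
      using assms(1) by (auto simp: invertibly_affine_off_def locally_affine_with_def)
    then obtain U where U: "open U" "z \<in> U" "\<And>x. x \<in> U \<Longrightarrow> f x = M *v x + c"
      by (auto simp: eventually_nhds)
    let ?h = "\<lambda>y. matrix_inv M *v y - matrix_inv M *v c"
    have "x \<in> ?h ` S" if "x \<in> U" "f x \<in> S" for x
      using that U(3) affine_inverse(1)[OF \<open>det M \<noteq> 0\<close>] by (metis imageI)
    moreover have "negligible (?h ` S)"
      by (intro negligible_differentiable_image_negligible assms(2) order_refl
          differentiable_on_diff differentiable_on_const linear_imp_differentiable_on
          matrix_vector_mul_linear)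
    ultimately have "negligible ((f -` S - N) \<inter> U)"
      by (rule_tac negligible_subset) auto
    then show "\<exists>V. openin (top_of_set (f -` S - N)) V \<and> z \<in> V \<and> negligible V"
      using U(1,2) z by (intro exI[of _ "(f -` S - N) \<inter> U"]) auto
  qed
  moreover have "negligible N"
    using assms(1) by (simp add: invertibly_affine_off_def)
  ultimately have "negligible ((f -` S - N) \<union> N)"
    by (rule negligible_Un)
  then show ?thesis
    by (rule negligible_subset) auto
qed

text \<open>If \<open>f\<close> is good at \<open>z\<close> and \<open>g\<close> is good at
  \<open>f z\<close>, the linear parts multiply and so do their determinants. Continuity of
  \<open>f\<close> keeps the preimage of \<open>S\<close> closed.\<close>

lemma invertibly_affine_off_compose:
  assumes f: "invertibly_affine_off N f" "continuous_on UNIV f" and g: "invertibly_affine_off S g"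
  shows "invertibly_affine_off (N \<union> f -` S) (g \<circ> f)"
proof -
  have "closed (f -` S)"
    using f(2) g by (auto simp: invertibly_affine_off_def intro: closed_vimage)
  moreover have "negligible (f -` S)"
    using negligible_vimage[OF f(1)] g by (simp add: invertibly_affine_off_def)
  moreover have "\<exists>M. locally_affine_with M (g \<circ> f) z \<and> det M \<noteq> 0" if "z \<notin> N \<union> f -` S" for z
  proof -
    obtain M L where "locally_affine_with M f z" "det M \<noteq> 0"
      "locally_affine_with L g (f z)" "det L \<noteq> 0"
      using \<open>z \<notin> N \<union> f -` S\<close> f(1) g by (fastforce simp: invertibly_affine_off_def)
    then show ?thesis
      using locally_affine_with_compose by (metis det_mul mult_eq_0_iff)
  qed
  ultimately show ?thesis
    using f(1) by (auto simp: invertibly_affine_off_def)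
qed

text \<open>Continuity is carried through the induction for the closedness of preimages, bijectivity
  so that \<open>inv f\<close> undoes \<open>f\<close> in the pushforward density.\<close>

lemma composed_relu_sylvester_affine_off:
  assumes "composed_relu_sylvester f"
  shows "bij f \<and> continuous_on UNIV f \<and> (\<exists>N. invertibly_affine_off N f)"
  using assms
proof induction
  case (single f)
  then show ?case
    using relu_sylvester_flow_affine_off continuous_on_sylvester_map
    by (metis relu_sylvester_flow_def normalizing_flow_def)
next
  case (comp g f)
  then have "bij g" "continuous_on UNIV g"
    using continuous_on_sylvester_map
    by (metis relu_sylvester_flow_def normalizing_flow_def)+
  then show ?case
    using comp relu_sylvester_flow_affine_off[OF comp(1)] invertibly_affine_off_compose
    by (metis bij_comp continuous_on_compose continuous_on_subset subset_UNIV)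
qed

section \<open>Gradients of log-densities under affine maps and flows\<close>

lemma gradient_eq: "GDERIV \<phi> x :> D \<Longrightarrow> gradient \<phi> x = D"
  unfolding gradient_def gderiv_def
  by (rule the_equality) (metis has_derivative_unique vector_eq_ldot)+

lemma GDERIV_gradient:
  fixes \<phi> :: "'a::euclidean_space \<Rightarrow> real"
  assumes "\<phi> differentiable (at x)"
  shows "GDERIV \<phi> x :> gradient \<phi> x"
proof -
  obtain L where L: "(\<phi> has_derivative L) (at x)"
    using assms by (auto simp: differentiable_def)
  \<comment> \<open>Riesz representation: the functional \<open>L\<close> is the inner product with
    \<open>adjoint L 1\<close>.\<close>
  have "L h = h \<bullet> adjoint L 1" for h
    using adjoint_works[OF has_derivative_linear[OF L], of h 1] by simp
  then have "L = (\<lambda>h. h \<bullet> adjoint L 1)" ..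
  with L have "GDERIV \<phi> x :> adjoint L 1"
    unfolding gderiv_def by metis
  then show ?thesis
    using gradient_eq by metis
qed

text \<open>The logarithm turns the factor \<open>k\<close> into an additive constant, which
  differentiation removes; the rest is the chain rule. With \<open>k\<close> and the affine map left
  general, the lemma applies both to a piece of the flow and to its inverse.\<close>

lemma gradient_log_affine_pullback:
  fixes p q :: "real^'n \<Rightarrow> real" and M :: "real^'n^'n"
  assumes pq: "\<forall>\<^sub>F x in nhds z. q x = k * p (M *v x + c)" and "k > 0"
    and p: "log_differentiable_at p (M *v z + c)"
  shows "log_differentiable_at q z"
    and "gradient (\<lambda>x. ln (q x)) z = transpose M *v gradient (\<lambda>x. ln (p x)) (M *v z + c)"
proof -
  let ?a = "\<lambda>x. M *v x + c"
  let ?G = "gradient (\<lambda>x. ln (p x)) (?a z)"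
  have a: "(?a has_derivative (*v) M) (at z)"
    by (intro has_derivative_add_const bounded_linear_imp_has_derivative
        matrix_vector_mul_bounded_linear)
  have "filterlim ?a (nhds (?a z)) (nhds z)"
    using has_derivative_continuous[OF a] by (rule isCont_filterlim_nhds)
  moreover have "\<forall>\<^sub>F y in nhds (?a z). 0 < p y"
    using p by (simp add: log_differentiable_at_def)
  ultimately have "\<forall>\<^sub>F x in nhds z. 0 < p (?a x)"
    by (rule eventually_compose_filterlim[rotated])
  \<comment> \<open>Positivity of \<open>p\<close> near the image point passes to \<open>q\<close>
    and allows the logarithm of the product to be split.\<close>
  with pq have ev: "\<forall>\<^sub>F x in nhds z. 0 < q x \<and> ln k + ln (p (?a x)) = ln (q x)"
    by eventually_elim (use \<open>k > 0\<close> in \<open>simp add: ln_mult\<close>)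
  have "((\<lambda>y. ln (p y)) has_derivative (\<lambda>h. h \<bullet> ?G)) (at (?a z))"
    using GDERIV_gradient p by (auto simp: log_differentiable_at_def gderiv_def)
  from has_derivative_add_const[OF has_derivative_compose[OF a this], of "ln k"]
  have "((\<lambda>x. ln k + ln (p (?a x))) has_derivative (\<lambda>h. (M *v h) \<bullet> ?G)) (at z)"
    by (simp add: add.commute)
  moreover have "(M *v h) \<bullet> ?G = h \<bullet> (transpose M *v ?G)" for h
    by (metis dot_lmul_matrix inner_commute transpose_matrix_vector)
  ultimately have "((\<lambda>x. ln k + ln (p (?a x))) has_derivative (\<lambda>h. h \<bullet> (transpose M *v ?G))) (at z)"
    by simp
  moreover have "\<forall>\<^sub>F x in at z. ln k + ln (p (?a x)) = ln (q x)"
    using ev by (auto simp: eventually_at_filter elim: eventually_mono)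
  moreover have "ln k + ln (p (?a z)) = ln (q z)"
    using eventually_nhds_x_imp_x[OF ev] by simp
  ultimately have "((\<lambda>x. ln (q x)) has_derivative (\<lambda>h. h \<bullet> (transpose M *v ?G))) (at z)"
    by (rule has_derivative_transform_eventually) simp
  then have D: "GDERIV (\<lambda>x. ln (q x)) z :> transpose M *v ?G"
    by (simp add: gderiv_def)
  then show "gradient (\<lambda>x. ln (q x)) z = transpose M *v ?G"
    by (rule gradient_eq)
  show "log_differentiable_at q z"
    using D ev unfolding log_differentiable_at_def gderiv_def differentiable_def
    by (auto elim: eventually_mono)
qed

text \<open>The pullback lemma is used along the affine piece with factor
  \<open>\<bar>det M\<bar>\<close>, which gives the gradient identity and differentiability of
  \<open>ln q\<close> from that of \<open>ln p\<close>, and along the inverse piece with the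
  reciprocal factor, which gives the converse.\<close>

lemma pushforward_density_locally_affine:
  fixes q :: "real^'n \<Rightarrow> real"
  assumes "bij f" "locally_affine_with M f z" "det M \<noteq> 0"
  defines "p \<equiv> pushforward_density f q"
  shows "log_differentiable_at q z \<longleftrightarrow> log_differentiable_at p (f z)"
    and "log_differentiable_at q z \<Longrightarrow>
      transpose M *v gradient (\<lambda>x. ln (p x)) (f z) = gradient (\<lambda>x. ln (q x)) z"
proof -
  obtain c where c: "\<forall>\<^sub>F x in nhds z. f x = M *v x + c"
    using assms(2) by (auto simp: locally_affine_with_def)
  have fz: "f z = M *v z + c"
    using eventually_nhds_x_imp_x[OF c] .
  have pf: "p (f x) = q x / \<bar>det M\<bar>" if "locally_affine_with M f x" for x
    using jacobian_locally_affine[OF that] assms(1)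
    by (simp add: p_def pushforward_density_def bij_is_inj)
  from c locally_affine_with_eventually[OF assms(2)]
  \<comment> \<open>\<open>locally_affine_with\<close> hides its offset, so the formula with the
    fixed \<open>c\<close> is kept beside it.\<close>
  have good: "\<forall>\<^sub>F x in nhds z. f x = M *v x + c \<and> locally_affine_with M f x"
    by (rule eventually_conj)
  have q: "\<forall>\<^sub>F x in nhds z. q x = \<bar>det M\<bar> * p (M *v x + c)"
    using good
  proof eventually_elim
    case (elim x)
    then have "p (M *v x + c) = q x / \<bar>det M\<bar>"
      using pf[of x] by simp
    then show ?case
      using assms(3) by simp
  qed
  \<comment> \<open>The inverse of the affine piece, written as a sum to fit the shape
    \<open>M *v x + c\<close> of the pullback lemma.\<close>
  let ?h = "\<lambda>y. matrix_inv M *v y + - (matrix_inv M *v c)"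
  have h: "M *v ?h y + c = y" for y
    using affine_inverse(2)[OF assms(3)] by simp
  have hz: "?h (f z) = z"
    using affine_inverse(1)[OF assms(3)] fz by simp
  have "isCont ?h (f z)"
    by (intro continuous_intros)
  then have "filterlim ?h (nhds z) (nhds (f z))"
    using isCont_filterlim_nhds hz by metis
  from eventually_compose_filterlim[OF good this]
  \<comment> \<open>For \<open>y\<close> near \<open>f z\<close> the point \<open>?h y\<close> is
    near \<open>z\<close>, so \<open>f (?h y) = y\<close> and the formula for \<open>p\<close> at
    images applies.\<close>
  have p: "\<forall>\<^sub>F y in nhds (f z). p y = inverse \<bar>det M\<bar> * q (?h y)"
    by eventually_elim (use pf h in \<open>metis divide_inverse_commute\<close>)
  have pos: "\<bar>det M\<bar> > 0" "inverse \<bar>det M\<bar> > 0"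
    using assms(3) by auto
  show iff: "log_differentiable_at q z \<longleftrightarrow> log_differentiable_at p (f z)"
    using gradient_log_affine_pullback(1)[OF p pos(2)] gradient_log_affine_pullback(1)[OF q pos(1)]
      hz fz by auto
  show "transpose M *v gradient (\<lambda>x. ln (p x)) (f z) = gradient (\<lambda>x. ln (q x)) z"
    if "log_differentiable_at q z"
    using gradient_log_affine_pullback(2)[OF q pos(1)] that iff fz by simp
qed

text \<open>\<open>jacobian\<close> and \<open>gradient\<close> are total, so regularity and the
  equivalence are what make both sides of the identity genuine derivatives.\<close>

theorem theorem4p1:
  fixes q p :: "real^'n \<Rightarrow> real" and f :: "real^'n \<Rightarrow> real^'n"
  assumes "CARD('n) > 1"
    and "prob_density q"
    and "composed_relu_sylvester f"
    and "p = pushforward_density f q"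
  shows "\<exists>\<Omega> :: (real^'n) set. closed \<Omega> \<and> \<Omega> \<in> null_sets lborel \<and>
    (\<forall>z \<in> UNIV - \<Omega>.
       regular_point f z \<and>
       (log_differentiable_at q z \<longleftrightarrow> log_differentiable_at p (f z)) \<and>
       (log_differentiable_at q z \<longrightarrow>
          transpose (jacobian f (at z)) *v gradient (\<lambda>x. ln (p x)) (f z)
            = gradient (\<lambda>x. ln (q x)) z))"
proof -
  obtain \<Omega> where "bij f" and \<Omega>: "invertibly_affine_off \<Omega> f"
    using composed_relu_sylvester_affine_off[OF assms(3)] by blast
  then have "closed \<Omega>" "negligible \<Omega>"
    by (auto simp: invertibly_affine_off_def)
  \<comment> \<open>\<open>negligible\<close> refers to the completed measure; a closed set is
    Borel, so it is null for \<open>lborel\<close> as well.\<close>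
  then have "\<Omega> \<in> null_sets lborel"
    by (simp add: negligible_iff_null_sets null_sets_completion_iff borel_closed)
  moreover have "regular_point f z \<and>
       (log_differentiable_at q z \<longleftrightarrow> log_differentiable_at p (f z)) \<and>
       (log_differentiable_at q z \<longrightarrow>
          transpose (jacobian f (at z)) *v gradient (\<lambda>x. ln (p x)) (f z)
            = gradient (\<lambda>x. ln (q x)) z)" if "z \<notin> \<Omega>" for z
  proof -
    obtain M where M: "locally_affine_with M f z" "det M \<noteq> 0"
      using \<Omega> \<open>z \<notin> \<Omega>\<close> by (auto simp: invertibly_affine_off_def)
    show ?thesis
      using regular_point_locally_affine[OF M] jacobian_locally_affine[OF M(1)]
        pushforward_density_locally_affine[OF \<open>bij f\<close> M, of q] assms(4) by auto
  qed
  ultimately show ?thesis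
    using \<open>closed \<Omega>\<close> by blast
qed

end
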